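(* Let $K$ be a positive integer and let $(a,b,c)$ be a triple of positive integers with $a=2K$, $a\geq b$, $a\geq c$, $b+c=2K+2$, $b$ and $c$ both even, and $\gcd(b,c)=2$. Then $(a,b,c)$ is a good triple.
   Context: For positive integers $a,b,c$ with $n=a+b+c$, the permutation of the triple $(a,b,c)$ is the permutation of $[n]$ with $p_i=n+1-i$ for $1\le i\le a$, $p_i=a+b+1-i$ for $a+1\le i\le a+b$, and $p_i=n+b+1-i$ for $a+b+1\le i\le n$ (one-line notation $n\cdots(n-a+1)\ b\cdots1\ (b+c)\cdots(b+1)$). The triple is good if this permutation, as a bijection $i\mapsto p_i$ of $[n]$, is a single $n$-cycle. *)

theory Defs
  imports "HOL-Combinatorics.Orbits"
begin

text \<open>The permutation of a triple, extended by the identity outside \<open>{1..a + b + c}\<close>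
  as required by \<^const>\<open>permutes\<close>. No subtraction on natural numbers truncates here.\<close>

definition triple_perm :: "nat \<Rightarrow> nat \<Rightarrow> nat \<Rightarrow> nat \<Rightarrow> nat" where
  "triple_perm a b c i =
    (let n = a + b + c in
      if 1 \<le> i \<and> i \<le> a then n + 1 - i
      else if a + 1 \<le> i \<and> i \<le> a + b then a + b + 1 - i
      else if a + b + 1 \<le> i \<and> i \<le> n then n + b + 1 - i
      else i)"

lemma triple_perm_permutes: "triple_perm a b c permutes {1..a + b + c}"
proof (rule bij_imp_permutes)
  have "inj_on (triple_perm a b c) {1..a + b + c}"
    by (rule inj_onI) (auto simp: triple_perm_def Let_def split: if_splits)
  moreover have "triple_perm a b c ` {1..a + b + c} \<subseteq> {1..a + b + c}"
    by (auto simp: triple_perm_def Let_def)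
  ultimately show "bij_betw (triple_perm a b c) {1..a + b + c} {1..a + b + c}"
    by (simp add: bij_betw_def endo_inj_surj)
qed (auto simp: triple_perm_def Let_def)

text \<open>Since \<^const>\<open>cyclic_on\<close> says that the set is one orbit, a good triple is one whose
  permutation is a single cycle of length \<open>a + b + c\<close>.\<close>

definition good_triple :: "nat \<Rightarrow> nat \<Rightarrow> nat \<Rightarrow> bool" where
  "good_triple a b c \<longleftrightarrow> cyclic_on (triple_perm a b c) {1..a + b + c}"

end

theory Submission
  imports Defs "HOL-Number_Theory.Cong"
begin

text \<open>Put \<open>m = K + 1\<close> and \<open>c = 2 * \<gamma>\<close>. The permutation is the rotation by \<open>c\<close> of the last
  \<open>b + c = 2 * m\<close> points, followed by the reversal of all \<open>n\<close> points. Its first-return map to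
  these last points is therefore the rotation followed by the transposition of the two points
  \<open>2 * m - 1\<close> and \<open>2 * m\<close>, the only ones that the reversal does not send among the first \<open>a\<close>.
  As \<open>gcd b c = 2\<close>, the rotation has exactly two cycles, one for each parity, and the
  transposition joins them.\<close>

lemma mod_mult_surj:
  fixes k m t :: nat
  assumes "coprime k m" "t < m"
  obtains j where "j < m" "(j * k) mod m = t"
proof -
  obtain x where x: "[k * x = 1] (mod m)"
    using cong_solve_coprime_nat[OF assms(1)] by auto
  have "[k * (x * t) = 1 * t] (mod m)"
    using cong_scalar_right[OF x, of t] by (simp add: mult.assoc)
  hence "((x * t) mod m * k) mod m = t"
    using assms(2) by (simp add: cong_def mod_mult_left_eq mod_mult_right_eq mult.commute)
  with that[of "(x * t) mod m"] assms(2) show thesis by auto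
qed

text \<open>In the coordinates \<open>e\<close>, \<open>t\<close> the rotation by 2\<gamma> keeps
  \<open>e\<close> and adds \<gamma> to \<open>t\<close> modulo \<open>m\<close>; the reversal x ->
  4m - 1 - x then gives the stated value. The two cases are the blocks of lengths 2\<beta> and
  2\<gamma>.\<close>

lemma triple_perm_upper:
  fixes m \<beta> \<gamma> e t :: nat
  defines "s \<equiv> (t + \<gamma>) mod m"
  assumes "m = \<beta> + \<gamma>" "\<beta> > 0" "t < m" "e \<le> 1"
  shows "triple_perm (2 * m - 2) (2 * \<beta>) (2 * \<gamma>) (2 * m - 1 + e + 2 * t) = 2 * m - e - 2 * s"
proof (cases "t < \<beta>")
  case True
  hence "s = t + \<gamma>" using assms by simp
  with True show ?thesis using assms by (auto simp: triple_perm_def Let_def)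
next
  case False
  hence "s = t - \<beta>" using assms by (simp add: mod_if)
  with False have "t = \<beta> + s" by simp
  moreover from this have "s < \<gamma>" using assms(2,4) by simp
  ultimately show ?thesis using assms(2,3,5) by (auto simp: triple_perm_def Let_def)
qed

text \<open>For s > 0 the point lies among the first 2m - 2, where the permutation is just the
  reversal. At s = 0 it would be 2m - e, which is still an upper point.\<close>

lemma triple_perm_lower:
  fixes m \<beta> \<gamma> e s :: nat
  assumes "m = \<beta> + \<gamma>" "0 < s" "s < m" "e \<le> 1"
  shows "triple_perm (2 * m - 2) (2 * \<beta>) (2 * \<gamma>) (2 * m - e - 2 * s) = 2 * m - 1 + e + 2 * s"
  using assms by (auto simp: triple_perm_def Let_def)

lemma good_triple_coprime:
  fixes m \<beta> \<gamma> :: nat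
  assumes m: "m = \<beta> + \<gamma>" and pos: "\<beta> > 0" "\<gamma> > 0" and cop: "coprime \<beta> \<gamma>"
  shows "good_triple (2 * m - 2) (2 * \<beta>) (2 * \<gamma>)"
proof -
  define f where "f = triple_perm (2 * m - 2) (2 * \<beta>) (2 * \<gamma>)"
  \<comment> \<open>\<open>P e\<close> lists one parity class in the order of its rotation cycle;
    \<open>P 0 0\<close> and \<open>P 1 0\<close> are the two transposed points.\<close>
  define P where "P e j = 2 * m - 1 + e + 2 * ((j * \<gamma>) mod m)" for e j :: nat
  define S where "S = {1..2 * m - 2 + 2 * \<beta> + 2 * \<gamma>}"
  define X where "X = orbit f (P 0 0)"
  have perm: "f permutes S"
    unfolding f_def S_def by (rule triple_perm_permutes)
  have cop': "coprime \<gamma> m"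
    unfolding m coprime_iff_gcd_eq_1 by (metis cop coprime_iff_gcd_eq_1 gcd.commute gcd_add1)
  have closed: "f x \<in> X" if "x \<in> X" for x
    using that unfolding X_def by (rule orbit.step)
  have "permutation f"
    using perm S_def permutation_permutes by blast
  hence start: "P 0 0 \<in> X"
    unfolding X_def by (rule permutation_self_in_orbit)
  have fP: "f (P e j) = 2 * m - e - 2 * ((Suc j * \<gamma>) mod m)" if "e \<le> 1" for e j
  proof -
    have "((j * \<gamma>) mod m + \<gamma>) mod m = (Suc j * \<gamma>) mod m"
      by (simp add: mod_simps add.commute)
    thus ?thesis
      using triple_perm_upper[OF m pos(1), of "(j * \<gamma>) mod m" e] that m pos
      by (simp add: f_def P_def)
  qed
  have run: "P e j \<in> X" if "P e 0 \<in> X" "e \<le> 1" "j < m" for e j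
    using \<open>j < m\<close>
  proof (induction j)
    case 0
    show ?case using that(1) .
  next
    case (Suc j)
    \<comment> \<open>Before a cycle closes, the image is a lower point, so two applications of
      \<open>f\<close> advance \<open>P e\<close> by one.\<close>
    have "\<not> m dvd Suc j * \<gamma>"
      using cop' Suc.prems by (metis coprime_commute coprime_dvd_mult_left_iff nat_dvd_not_less zero_less_Suc)
    hence "0 < (Suc j * \<gamma>) mod m"
      by (simp add: dvd_eq_mod_eq_0)
    hence "f (f (P e j)) = P e (Suc j)"
      using triple_perm_lower[OF m, of "(Suc j * \<gamma>) mod m" e] that(2) m pos
      by (simp only: fP) (simp add: f_def P_def)
    thus ?case using Suc closed by (metis Suc_lessD)
  qed
  \<comment> \<open>Here the residue is 0, so \<open>f\<close> lands on 2m, the start of the other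
    class, instead of closing the cycle at 2m - 1.\<close>
  have "f (P 0 (m - 1)) = P 1 0"
    using fP[of 0 "m - 1"] m pos by (simp add: P_def)
  hence "P 1 0 \<in> X"
    using run[OF start, of "m - 1"] closed m pos by fastforce
  hence runs: "P e j \<in> X" if "e \<le> 1" "j < m" for e j
    using run[of e j] start that by (cases "e = 0") (auto simp: le_Suc_eq)
  have upper: "2 * m - 1 + e + 2 * t \<in> X" if "e \<le> 1" "t < m" for e t
  proof -
    obtain j where "j < m" "(j * \<gamma>) mod m = t"
      using mod_mult_surj[OF cop' \<open>t < m\<close>] .
    thus ?thesis using runs[OF that(1), of j] by (simp add: P_def)
  qed
  have big: "x \<in> X" if "2 * m - 1 \<le> x" "x \<in> S" for x
  proof -
    define d where "d = x - (2 * m - 1)"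
    have "x = 2 * m - 1 + d mod 2 + 2 * (d div 2)" "d div 2 < m"
      using that m pos by (auto simp: d_def S_def)
    thus ?thesis using upper[of "d mod 2" "d div 2"] by simp
  qed
  have "S \<subseteq> X"
  proof
    fix y assume "y \<in> S"
    then obtain x where x: "x \<in> S" "f x = y"
      using permutes_image[OF perm] by (metis imageE)
    show "y \<in> X"
    proof (cases "2 * m - 1 \<le> y")
      case True
      thus ?thesis using big \<open>y \<in> S\<close> by blast
    next
      case False
      \<comment> \<open>The reversal sends the first 2m - 2 points to 2m + 1 and above, so the
        preimage of a lower point is an upper one.\<close>
      hence "2 * m - 1 \<le> x"
        using x m by (auto simp: f_def S_def triple_perm_def Let_def split: if_splits)
      hence "x \<in> X" using big x(1) by blast
      thus ?thesis using closed x(2) by blast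
    qed
  qed
  moreover have "P 0 0 \<in> S"
    using m pos by (auto simp: P_def S_def)
  moreover from this have "X \<subseteq> S"
    unfolding X_def by (rule permutes_orbit_subset[OF perm])
  ultimately show ?thesis
    unfolding good_triple_def cyclic_on_def using X_def S_def f_def by blast
qed

theorem theorem16:
  fixes K a b c :: nat
  assumes "K > 0" and "a > 0" and "b > 0" and "c > 0"
    and "a = 2 * K" and "a \<ge> b" and "a \<ge> c"
    and "b + c = 2 * K + 2"
    and "even b" and "even c"
    and "gcd b c = 2"
  shows "good_triple a b c"
proof -
  obtain \<beta> \<gamma> where bc: "b = 2 * \<beta>" "c = 2 * \<gamma>"
    using assms(9,10) by (auto elim!: evenE)
  have "2 * gcd \<beta> \<gamma> = 2"
    using assms(11) unfolding bc by (simp add: gcd_mult_distrib_nat)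
  hence "coprime \<beta> \<gamma>"
    by (simp add: coprime_iff_gcd_eq_1)
  moreover have "a = 2 * (\<beta> + \<gamma>) - 2"
    using assms(5,8) bc by simp
  ultimately show ?thesis
    using good_triple_coprime[OF refl, of \<beta> \<gamma>] assms(3,4) bc by simp
qed

end
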